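(* A finite monoid $S$ is a weakly ordered monoid if and only if it is an $R$-trivial monoid.
   Context: Preorder: for $u,v$ in a monoid $S$, $u\le v$ means there is $w\in S$ with $uw=v$. A finite monoid $S$ is a weakly ordered monoid if there exist a finite upper semi-lattice $(\mathcal{L},\preceq)$ (a finite poset in which any two elements have a join $\vee$) and two maps $C,D:S\to\mathcal{L}$ such that: (1) $C$ is a monoid morphism, i.e. $C(uv)=C(u)\vee C(v)$ for all $u,v\in S$; (2) $C$ is surjective; (3) if $u,v\in S$ are such that $uv\le u$, then $C(v)\preceq D(u)$; (4) if $u,v\in S$ are such that $C(v)\preceq D(u)$, then $uv=u$. A monoid $S$ is $R$-trivial if for all $x,y\in S$, $xS=yS$ implies $x=y$. *)

theory Defs
  imports "HOL-Algebra.Lattice" "HOL-Algebra.Divisibility"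
begin

text \<open>
  The preorder \<open>u \<le> v\<close> on a monoid (there is \<open>w\<close> with \<open>u w = v\<close>) is the library's relation
  \<open>u divides v\<close>, whose definition does not assume commutativity.  No condition
  \<open>C \<one> = \<bottom>\<close> is imposed: it follows from multiplicativity and surjectivity of \<open>C\<close>.
\<close>

definition weakly_ordered_structure ::
    "('a, 'm) monoid_scheme \<Rightarrow> 'l gorder \<Rightarrow> ('a \<Rightarrow> 'l) \<Rightarrow> ('a \<Rightarrow> 'l) \<Rightarrow> bool" where
  "weakly_ordered_structure S L C D \<longleftrightarrow>
     monoid S \<and> finite (carrier S) \<and>
     upper_semilattice L \<and> finite (carrier L) \<and>
     C \<in> carrier S \<rightarrow> carrier L \<and> D \<in> carrier S \<rightarrow> carrier L \<and>
     (\<forall>u\<in>carrier S. \<forall>v\<in>carrier S. C (u \<otimes>\<^bsub>S\<^esub> v) = C u \<squnion>\<^bsub>L\<^esub> C v) \<and>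
     C ` carrier S = carrier L \<and>
     (\<forall>u\<in>carrier S. \<forall>v\<in>carrier S. (u \<otimes>\<^bsub>S\<^esub> v) divides\<^bsub>S\<^esub> u \<longrightarrow> C v \<sqsubseteq>\<^bsub>L\<^esub> D u) \<and>
     (\<forall>u\<in>carrier S. \<forall>v\<in>carrier S. C v \<sqsubseteq>\<^bsub>L\<^esub> D u \<longrightarrow> u \<otimes>\<^bsub>S\<^esub> v = u)"

text \<open>
  HOL has no quantification over types, so the semilattice is taken on a finite set of
  natural numbers.  This is no restriction: see \<open>weakly_ordered_monoidI\<close> below.
\<close>

definition weakly_ordered_monoid :: "('a, 'm) monoid_scheme \<Rightarrow> bool" where
  "weakly_ordered_monoid S \<longleftrightarrow>
     (\<exists>(L :: nat gorder) C D. weakly_ordered_structure S L C D)"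

definition R_trivial :: "('a, 'm) monoid_scheme \<Rightarrow> bool" where
  "R_trivial S \<longleftrightarrow>
     (\<forall>x\<in>carrier S. \<forall>y\<in>carrier S.
        x <#\<^bsub>S\<^esub> carrier S = y <#\<^bsub>S\<^esub> carrier S \<longrightarrow> x = y)"

lemma weakly_ordered_monoidI:
  fixes L :: "'l gorder"
  assumes "weakly_ordered_structure S L C D"
  shows "weakly_ordered_monoid S"
proof -
  have fin: "finite (carrier L)" and "upper_semilattice L"
    and CD: "C \<in> carrier S \<rightarrow> carrier L" "D \<in> carrier S \<rightarrow> carrier L"
    and S: "monoid S"
    using assms by (auto simp: weakly_ordered_structure_def)
  interpret L: upper_semilattice L by fact
  obtain f :: "'l \<Rightarrow> nat" where f: "inj_on f (carrier L)"
    using finite_imp_inj_to_nat_seg[OF fin] by blast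
  define g where "g = inv_into (carrier L) f"
  have g: "g (f x) = x" if "x \<in> carrier L" for x
    using f that by (simp add: g_def)
  define M :: "nat gorder" where
    "M = \<lparr>carrier = f ` carrier L, eq = (=), le = (\<lambda>a b. g a \<sqsubseteq>\<^bsub>L\<^esub> g b)\<rparr>"
  have car: "carrier M = f ` carrier L" by (simp add: M_def)
  have leM: "f x \<sqsubseteq>\<^bsub>M\<^esub> f y \<longleftrightarrow> x \<sqsubseteq>\<^bsub>L\<^esub> y"
    if "x \<in> carrier L" "y \<in> carrier L" for x y
    using that by (simp add: M_def g)
  have po: "partial_order M"
  proof
    show "(.=\<^bsub>M\<^esub>) = (=)" by (simp add: M_def)
  next
    fix x y assume "x \<sqsubseteq>\<^bsub>M\<^esub> y" "y \<sqsubseteq>\<^bsub>M\<^esub> x" "x \<in> carrier M" "y \<in> carrier M"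
    then have "x = y" by (auto simp: car leM dest: L.le_antisym)
    then show "x .=\<^bsub>M\<^esub> y" by (simp add: M_def)
  qed (auto simp: M_def g intro: L.le_trans)
  have least: "least M (f (x \<squnion>\<^bsub>L\<^esub> y)) (Upper M {f x, f y})"
    if xy: "x \<in> carrier L" "y \<in> carrier L" for x y
    using xy L.join_left[OF xy] L.join_right[OF xy] L.join_closed[OF xy]
    by (auto simp: least_def Upper_def car leM intro!: L.join_le)
  interpret M: upper_semilattice M
    using po least
    by (auto simp: upper_semilattice_def upper_semilattice_axioms_def car)
  have join: "f x \<squnion>\<^bsub>M\<^esub> f y = f (x \<squnion>\<^bsub>L\<^esub> y)"
    if "x \<in> carrier L" "y \<in> carrier L" for x y
    unfolding join_def sup_def[of M]
    using least[OF that] M.least_unique by (metis join_def someI_ex)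
  have mem: "C u \<in> carrier L" "D u \<in> carrier L" if "u \<in> carrier S" for u
    using CD that by auto
  have "weakly_ordered_structure S M (f \<circ> C) (f \<circ> D)"
    using assms M.upper_semilattice_axioms mem
    unfolding weakly_ordered_structure_def
    by (simp add: car leM join Pi_iff) (metis image_image)
  then show ?thesis
    unfolding weakly_ordered_monoid_def by blast
qed

end

theory Submission
  imports Defs
begin

text \<open>
  In an \<open>R\<close>-trivial monoid, \<open>u v w = u\<close> forces \<open>u v = u\<close> and \<open>u w = u\<close>.  Hence the set \<open>C v\<close> of
  all \<open>u\<close> that \<open>v\<close> does not fix satisfies \<open>C (v w) = C v \<union> C w\<close>, and the image of \<open>C\<close> ordered by
  inclusion is a semilattice.  Taking for \<open>D u\<close> the union of \<open>C v\<close> over the stabilizer of \<open>u\<close>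
  gives \<open>C v \<subseteq> D u\<close> if and only if \<open>u v = u\<close>, because \<open>u\<close> itself is not in \<open>D u\<close>.
\<close>

definition moved :: "('a, 'm) monoid_scheme \<Rightarrow> 'a \<Rightarrow> 'a set" where
  "moved S v = {u \<in> carrier S. u \<otimes>\<^bsub>S\<^esub> v \<noteq> u}"

definition stab :: "('a, 'm) monoid_scheme \<Rightarrow> 'a \<Rightarrow> 'a set" where
  "stab S u = {v \<in> carrier S. u \<otimes>\<^bsub>S\<^esub> v = u}"

text \<open>The carrier is an arbitrary family \<open>A\<close>, so that taking the image of
  \<open>moved S\<close> for it makes \<open>C\<close> surjective by construction.\<close>

definition inclusion_order :: "'a set set \<Rightarrow> 'a set gorder" where
  "inclusion_order A = \<lparr>carrier = A, eq = (=), le = (\<subseteq>)\<rparr>"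

lemma inclusion_order_simps [simp]:
  "carrier (inclusion_order A) = A"
  "x \<sqsubseteq>\<^bsub>inclusion_order A\<^esub> y \<longleftrightarrow> x \<subseteq> y"
  by (simp_all add: inclusion_order_def)

lemma inclusion_order_union_least:
  assumes "x \<in> A" "y \<in> A" "x \<union> y \<in> A"
  shows "least (inclusion_order A) (x \<union> y) (Upper (inclusion_order A) {x, y})"
  using assms by (auto simp: least_def Upper_def)

lemma inclusion_order_partial_order: "partial_order (inclusion_order A)"
  by unfold_locales (auto simp: inclusion_order_def)

lemma inclusion_order_upper_semilattice:
  assumes "\<And>x y. x \<in> A \<Longrightarrow> y \<in> A \<Longrightarrow> x \<union> y \<in> A"
  shows "upper_semilattice (inclusion_order A)"
  using assms inclusion_order_partial_order[of A] inclusion_order_union_least[of _ A]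
  unfolding upper_semilattice_def upper_semilattice_axioms_def
  by (metis inclusion_order_simps(1))

lemma inclusion_order_join:
  assumes "x \<in> A" "y \<in> A" "x \<union> y \<in> A"
  shows "x \<squnion>\<^bsub>inclusion_order A\<^esub> y = x \<union> y"
proof -
  interpret partial_order "inclusion_order A" by (rule inclusion_order_partial_order)
  show ?thesis
    \<comment> \<open>The join is a Hilbert choice among least upper bounds; antisymmetry makes
      these unique, so the choice has to return the union.\<close>
    unfolding join_def sup_def
    using inclusion_order_union_least[OF assms] least_unique by (metis someI_ex)
qed

text \<open>Since \<open>x divides y\<close> puts \<open>y\<close> into \<open>x S\<close>, mutual
  divisibility amounts to \<open>x S = y S\<close>.\<close>

lemma R_trivial_antisym:
  assumes "monoid S" "R_trivial S" "x \<in> carrier S" "y \<in> carrier S"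
    "x divides\<^bsub>S\<^esub> y" "y divides\<^bsub>S\<^esub> x"
  shows "x = y"
proof -
  interpret monoid S by fact
  have "b <#\<^bsub>S\<^esub> carrier S \<subseteq> a <#\<^bsub>S\<^esub> carrier S" if "a divides\<^bsub>S\<^esub> b" "a \<in> carrier S" for a b
    using that by (auto simp: factor_def l_coset_def m_assoc)
  then have "x <#\<^bsub>S\<^esub> carrier S = y <#\<^bsub>S\<^esub> carrier S" using assms by blast
  then show ?thesis using assms by (auto simp: R_trivial_def)
qed

text \<open>If \<open>u v w = u\<close>, then \<open>u\<close> and \<open>u v\<close> divide each
  other, so \<open>u v = u\<close> by antisymmetry; substituting this back leaves
  \<open>u w = u\<close>.\<close>

lemma R_trivial_fixes_mult_iff:
  assumes "monoid S" "R_trivial S" "u \<in> carrier S" "v \<in> carrier S" "w \<in> carrier S"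
  shows "u \<otimes>\<^bsub>S\<^esub> (v \<otimes>\<^bsub>S\<^esub> w) = u \<longleftrightarrow> u \<otimes>\<^bsub>S\<^esub> v = u \<and> u \<otimes>\<^bsub>S\<^esub> w = u"
proof -
  interpret monoid S by fact
  have "u \<otimes>\<^bsub>S\<^esub> v = u" if "u \<otimes>\<^bsub>S\<^esub> v \<otimes>\<^bsub>S\<^esub> w = u"
  proof (rule R_trivial_antisym[OF assms(1,2)])
    show "u \<otimes>\<^bsub>S\<^esub> v divides\<^bsub>S\<^esub> u" using that assms by (metis dividesI)
    show "u divides\<^bsub>S\<^esub> u \<otimes>\<^bsub>S\<^esub> v" using assms by (intro dividesI) auto
  qed (use assms in auto)
  then show ?thesis using assms by (auto simp: m_assoc [symmetric])
qed

lemma R_trivial_moved_mult: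
  assumes "monoid S" "R_trivial S" "v \<in> carrier S" "w \<in> carrier S"
  shows "moved S (v \<otimes>\<^bsub>S\<^esub> w) = moved S v \<union> moved S w"
  using R_trivial_fixes_mult_iff[OF assms(1,2) _ assms(3,4)] by (auto simp: moved_def)

text \<open>The union is \<open>moved S\<close> of the product of the elements of \<open>A\<close>,
  taken in any order. With \<open>A\<close> a stabilizer, this places the values of \<open>D\<close>
  in the semilattice.\<close>

lemma R_trivial_UN_moved:
  assumes "monoid S" "R_trivial S" "finite A" "A \<noteq> {}" "A \<subseteq> carrier S"
  shows "(\<Union>v\<in>A. moved S v) \<in> moved S ` carrier S"
  using assms(3-5)
proof (induction rule: finite_ne_induct)
  case (insert x F)
  then obtain y where "y \<in> carrier S" "(\<Union>v\<in>F. moved S v) = moved S y" by auto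
  with insert.prems show ?case
    using R_trivial_moved_mult[OF assms(1,2), of x y] assms(1)
    by (auto intro!: image_eqI[of _ _ "x \<otimes>\<^bsub>S\<^esub> y"] monoid.m_closed)
qed auto

lemma weakly_ordered_structure_imp_R_trivial:
  assumes "weakly_ordered_structure S L C D"
  shows "R_trivial S"
  unfolding R_trivial_def
proof (intro ballI impI)
  fix x y assume x: "x \<in> carrier S" and y: "y \<in> carrier S"
    and eq: "x <#\<^bsub>S\<^esub> carrier S = y <#\<^bsub>S\<^esub> carrier S"
  interpret monoid S using assms by (simp add: weakly_ordered_structure_def)
  have self: "z \<in> z <#\<^bsub>S\<^esub> carrier S" if "z \<in> carrier S" for z
    using that by (auto simp: l_coset_def intro!: bexI[of _ "\<one>\<^bsub>S\<^esub>"])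
  obtain a where a: "a \<in> carrier S" "x = y \<otimes>\<^bsub>S\<^esub> a"
    using self[OF x] eq by (auto simp: l_coset_def)
  obtain b where b: "b \<in> carrier S" "y = x \<otimes>\<^bsub>S\<^esub> b"
    using self[OF y] eq by (auto simp: l_coset_def)
  \<comment> \<open>The cofactor is \<open>a\<close>: \<open>x b a = y a = x\<close>.\<close>
  have "x \<otimes>\<^bsub>S\<^esub> b divides\<^bsub>S\<^esub> x" using a b by (metis dividesI)
  \<comment> \<open>The third axiom gives that \<open>C b\<close> lies below \<open>D x\<close>, and
    the fourth turns this into \<open>x b = x\<close>.\<close>
  then have "x \<otimes>\<^bsub>S\<^esub> b = x"
    using assms x b unfolding weakly_ordered_structure_def by blast
  then show "x = y" using b by simp
qed

lemma R_trivial_weakly_ordered_structure: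
  assumes "monoid S" "finite (carrier S)" "R_trivial S"
  shows "weakly_ordered_structure S (inclusion_order (moved S ` carrier S))
    (moved S) (\<lambda>u. \<Union>v\<in>stab S u. moved S v)"
proof -
  interpret monoid S by fact
  let ?A = "moved S ` carrier S"
  let ?D = "\<lambda>u. \<Union>v\<in>stab S u. moved S v"
  note mult = R_trivial_moved_mult[OF assms(1,3)]
  have un: "x \<union> y \<in> ?A" if "x \<in> ?A" "y \<in> ?A" for x y
    using that by (auto simp: mult [symmetric])
  have D: "?D u \<in> ?A" if "u \<in> carrier S" for u
  proof (rule R_trivial_UN_moved[OF assms(1,3)])
    show "stab S u \<noteq> {}" using that by (auto simp: stab_def intro: exI[of _ "\<one>\<^bsub>S\<^esub>"])
  qed (use assms(2) in \<open>auto simp: stab_def\<close>)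
  have le: "moved S v \<subseteq> ?D u \<longleftrightarrow> u \<otimes>\<^bsub>S\<^esub> v = u" if "u \<in> carrier S" "v \<in> carrier S" for u v
    using that by (auto simp: moved_def stab_def)
  have div: "u \<otimes>\<^bsub>S\<^esub> v = u" if "u \<in> carrier S" "v \<in> carrier S" "u \<otimes>\<^bsub>S\<^esub> v divides\<^bsub>S\<^esub> u" for u v
    using that assms by (intro R_trivial_antisym[of S]) auto
  \<comment> \<open>The fourth axiom is one direction of \<open>le\<close>; the third is
    \<open>div\<close> followed by the other direction.\<close>
  show ?thesis
    unfolding weakly_ordered_structure_def
    using assms(1,2) inclusion_order_upper_semilattice[OF un] D le div
    by (auto simp: inclusion_order_join un mult)
qed

theorem theorem2p18:
  fixes S :: "('a, 'm) monoid_scheme"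
  assumes "monoid S" and "finite (carrier S)"
  shows "weakly_ordered_monoid S \<longleftrightarrow> R_trivial S"
  \<comment> \<open>The constructed semilattice consists of subsets of the monoid, so
    \<open>weakly_ordered_monoidI\<close> is what carries it over to natural numbers.\<close>
  using R_trivial_weakly_ordered_structure[OF assms] weakly_ordered_monoidI
    weakly_ordered_structure_imp_R_trivial
  unfolding weakly_ordered_monoid_def by blast

end
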